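(* Let $D:C^p(\Omega)\to F=C(\Omega)$ be a linear differential operator of order $p$ on a compact domain $\Omega\subset\mathbb{R}^d$. Then for any choice $(U_r,F_r)$ of finite-dimensional trial spaces of particular solutions with $F_r=D(U_r)$, there is a finite set $X\subset\Omega$ such that the discretized approximation problem in the sup norm on $X$ is uniformly stable, i.e. the full approximation error is at most twice the discrete approximation error.
   Context: For a set $S$, $\|g\|_{\infty,S}:=\sup_{x\in S}|g(x)|$, and $F=C(\Omega)$ carries the norm $\|\cdot\|_{\infty,\Omega}$. Trial spaces of particular solutions are spaces $U_r\subset C^p(\Omega)$ and $F_r=D(U_r)\subset F$ spanned by the components of pairs $(u_j,f_j)=(u_j,D(u_j))$ of trial functions. Given $f\in F$, the full approximation problem is to minimize $\|f-f_r\|_{\infty,\Omega}$ over $f_r\in F_r$, and the full approximation error is $\inf_{f_r\in F_r}\|f-f_r\|_{\infty,\Omega}$. The discretized approximation problem on $X$ is to minimize $\|f-f_r\|_{\infty,X}$ over $f_r\in F_r$, and the discrete approximation error is $\inf_{f_r\in F_r}\|f-f_r\|_{\infty,X}$. Stability of the discretization refers to a stability inequality $\|f_r\|_{\infty,\Omega}\le C\,\|f_r\|_{\infty,X}$ for all $f_r\in F_r$. Stability is uniform if $C$ is bounded independently of the trial space and of the discretization.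
   Formalization: The finite set X may depend on the given f as well as on the trial spaces: no single X gives the error comparison for all f in C(Ω), since some f outside F_r vanishes on X. Stability on F_r with C = 2 is included, and for it alone X can be chosen independently of f. *)

theory Defs
  imports "HOL-Analysis.Analysis"
begin

text \<open>
  A function on a set \<open>S\<close> is represented by a total function whose values outside \<open>S\<close> are
  irrelevant: nothing below depends on the values outside \<open>S\<close>.
\<close>

definition sup_norm_on :: "'a set \<Rightarrow> ('a \<Rightarrow> real) \<Rightarrow> real" where
  "sup_norm_on S g = (SUP x\<in>S. \<bar>g x\<bar>)"

text \<open>
  The closure of a nonempty bounded open set. Connectedness is deliberately not required. The
  regularity condition makes the interior dense in \<open>\<Omega>\<close>, so that continuous functions on \<open>\<Omega>\<close> are
  determined by their values in the interior.
\<close>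

definition compact_domain :: "(real ^ 'd) set \<Rightarrow> bool" where
  "compact_domain \<Omega> \<longleftrightarrow> compact \<Omega> \<and> \<Omega> \<noteq> {} \<and> closure (interior \<Omega>) = \<Omega>"

definition C_space :: "'a::topological_space set \<Rightarrow> ('a \<Rightarrow> real) set" where
  "C_space \<Omega> = {f. continuous_on \<Omega> f}"

definition partial :: "'d \<Rightarrow> (real ^ 'd \<Rightarrow> real) \<Rightarrow> (real ^ 'd \<Rightarrow> real)" where
  "partial i u x = deriv (\<lambda>t. u (x + t *\<^sub>R axis i 1)) 0"

text \<open>\<open>iter_partial [i\<^sub>1, \<dots>, i\<^sub>k] u\<close> is \<open>\<partial>\<^bsub>i\<^sub>1\<^esub> (\<dots> (\<partial>\<^bsub>i\<^sub>k\<^esub> u))\<close>.\<close>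

fun iter_partial :: "'d list \<Rightarrow> (real ^ 'd \<Rightarrow> real) \<Rightarrow> (real ^ 'd \<Rightarrow> real)" where
  "iter_partial [] u = u"
| "iter_partial (i # ks) u = partial i (iter_partial ks u)"

text \<open>
  \<open>C\<^sup>p(\<Omega>)\<close> for a compact domain: continuous on \<open>\<Omega>\<close>, all partial derivatives up to order \<open>p\<close> exist
  in the interior and extend continuously to \<open>\<Omega>\<close>. Existence has to be required explicitly, since
  \<open>deriv\<close> is total.
\<close>

definition Cp_space :: "nat \<Rightarrow> (real ^ 'd) set \<Rightarrow> (real ^ 'd \<Rightarrow> real) set" where
  "Cp_space p \<Omega> = {u. continuous_on \<Omega> u \<and>
     (\<forall>ks. length ks < p \<longrightarrow> (\<forall>i. \<forall>x\<in>interior \<Omega>.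
        (\<lambda>t::real. iter_partial ks u (x + t *\<^sub>R axis i 1)) differentiable (at 0))) \<and>
     (\<forall>ks. length ks \<le> p \<longrightarrow>
        (\<exists>g. continuous_on \<Omega> g \<and> (\<forall>x\<in>interior \<Omega>. g x = iter_partial ks u x)))}"

text \<open>
  \<open>D u = \<Sum>\<^bsub>k \<le> p\<^esub> \<Sum>\<^bsub>i\<^sub>1,\<dots>,i\<^sub>k\<^esub> a\<^bsub>i\<^sub>1\<dots>i\<^sub>k\<^esub> \<partial>\<^bsub>i\<^sub>1\<^esub>\<dots>\<partial>\<^bsub>i\<^sub>k\<^esub> u\<close> with coefficients in \<open>C(\<Omega>)\<close>; mixed
  derivatives commute on \<open>C\<^sup>p\<close>, so summing over index tuples gives the same operators as summing over
  multi-indices. The formula is imposed in the interior, where the derivatives are defined;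
  continuity of \<open>D u\<close> then determines \<open>D u\<close> on the boundary as well. Order \<open>p\<close> means at most \<open>p\<close>.
\<close>

definition linear_differential_operator ::
  "nat \<Rightarrow> (real ^ 'd) set \<Rightarrow> ((real ^ 'd \<Rightarrow> real) \<Rightarrow> (real ^ 'd \<Rightarrow> real)) \<Rightarrow> bool" where
  "linear_differential_operator p \<Omega> D \<longleftrightarrow>
     (\<forall>u\<in>Cp_space p \<Omega>. D u \<in> C_space \<Omega>) \<and>
     (\<exists>a :: 'd list \<Rightarrow> real ^ 'd \<Rightarrow> real.
        (\<forall>ks. length ks \<le> p \<longrightarrow> a ks \<in> C_space \<Omega>) \<and>
        (\<forall>u\<in>Cp_space p \<Omega>. \<forall>x\<in>interior \<Omega>.
           D u x = (\<Sum>ks | length ks \<le> p. a ks x * iter_partial ks u x)))"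

definition lin_comb_space :: "nat \<Rightarrow> (nat \<Rightarrow> 'a \<Rightarrow> real) \<Rightarrow> ('a \<Rightarrow> real) set" where
  "lin_comb_space n u = {\<lambda>x. \<Sum>j<n. c j * u j x | c :: nat \<Rightarrow> real. True}"

text \<open>
  \<open>F = D(U)\<close> is, as a space of functions on \<open>\<Omega>\<close>, the span of \<open>f\<^sub>j = D u\<^sub>j\<close>.
\<close>

definition trial_spaces ::
  "nat \<Rightarrow> (real ^ 'd) set \<Rightarrow> ((real ^ 'd \<Rightarrow> real) \<Rightarrow> (real ^ 'd \<Rightarrow> real)) \<Rightarrow>
   (real ^ 'd \<Rightarrow> real) set \<Rightarrow> (real ^ 'd \<Rightarrow> real) set \<Rightarrow> bool" where
  "trial_spaces p \<Omega> D U F \<longleftrightarrow>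
     (\<exists>n u. (\<forall>j<n. u j \<in> Cp_space p \<Omega>) \<and> U = lin_comb_space n u) \<and> F = D ` U"

text \<open>Full approximation error for \<open>S = \<Omega>\<close>, discrete approximation error for \<open>S = X\<close>.\<close>

definition approx_error :: "'a set \<Rightarrow> ('a \<Rightarrow> real) \<Rightarrow> ('a \<Rightarrow> real) set \<Rightarrow> real" where
  "approx_error S f F = (INF g\<in>F. sup_norm_on S (\<lambda>x. f x - g x))"

definition stable_discretization :: "real \<Rightarrow> 'a set \<Rightarrow> 'a set \<Rightarrow> ('a \<Rightarrow> real) set \<Rightarrow> bool" where
  "stable_discretization C \<Omega> X F \<longleftrightarrow> (\<forall>g\<in>F. sup_norm_on \<Omega> g \<le> C * sup_norm_on X g)"

end

theory Submission
  imports Defs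
begin

text \<open>
  On \<open>\<Omega>\<close>, the space \<open>F\<close> is the span of finitely many continuous functions \<open>D u\<^sub>j\<close>. Adjoin \<open>f\<close> to
  get a finite-dimensional space \<open>V\<close> that contains \<open>F\<close> and all the residuals \<open>f - g\<close> with \<open>g \<in> F\<close>.
  One finite set \<open>X\<close> with \<open>\<parallel>v\<parallel>\<^bsub>\<infinity>,\<Omega>\<^esub> \<le> 2 \<parallel>v\<parallel>\<^bsub>\<infinity>,X\<^esub>\<close> for every \<open>v \<in> V\<close> then settles both claims:
  elements of \<open>F\<close> give stability, and residuals, after taking the infimum over \<open>F\<close>, give the
  comparison of the errors.

  Such an \<open>X\<close> exists for any finite-dimensional space of continuous functions on a compact set, and
  for any constant greater than \<open>1\<close> (\<open>finite_norming_set\<close>). By \<open>finite_interpolation\<close> there are points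
  \<open>y\<^sub>i\<close> and continuous \<open>l\<^sub>i\<close> with \<open>v x = (\<Sum>i. v (y\<^sub>i) * l\<^sub>i x)\<close> for all \<open>v \<in> V\<close>. By compactness there
  is a finite set of points \<open>z\<close> such that every \<open>x\<close> has one with \<open>(\<Sum>i. \<bar>l\<^sub>i x - l\<^sub>i z\<bar>) < \<epsilon>\<close>, and then
  \<open>\<bar>v x\<bar> \<le> \<bar>v z\<bar> + \<epsilon> * max\<^sub>i \<bar>v (y\<^sub>i)\<bar>\<close>. So the points \<open>z\<close> and \<open>y\<^sub>i\<close> together form a norming set with
  constant \<open>1 + \<epsilon>\<close>.

  That \<open>F\<close> is the span of the \<open>D u\<^sub>j\<close> is linearity of \<open>D\<close>, which holds first in the interior of \<open>\<Omega>\<close>,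
  where \<open>D\<close> is given by partial derivatives, and then on all of \<open>\<Omega>\<close> by continuity, since the interior
  is dense (\<open>differential_operator_linear\<close>).
\<close>

section \<open>The sup norm over a set\<close>

lemma abs_le_sup_norm_on:
  assumes "bdd_above ((\<lambda>x. \<bar>g x\<bar>) ` S)" "x \<in> S"
  shows "\<bar>g x\<bar> \<le> sup_norm_on S g"
  unfolding sup_norm_on_def using assms by (intro cSUP_upper)

lemma sup_norm_on_least:
  assumes "S \<noteq> {}" "\<And>x. x \<in> S \<Longrightarrow> \<bar>g x\<bar> \<le> B"
  shows "sup_norm_on S g \<le> B"
  unfolding sup_norm_on_def using assms by (intro cSUP_least) auto

lemma sup_norm_on_nonneg:
  assumes "S \<noteq> {}" "bdd_above ((\<lambda>x. \<bar>g x\<bar>) ` S)"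
  shows "0 \<le> sup_norm_on S g"
proof -
  obtain x where "x \<in> S" using assms(1) by blast
  then have "\<bar>g x\<bar> \<le> sup_norm_on S g" by (intro abs_le_sup_norm_on assms(2))
  then show ?thesis by linarith
qed

section \<open>Finite norming sets for finite-dimensional function spaces\<close>

text \<open>
  A generalized Lagrange basis: the identity is linear in \<open>g\<close>, so it extends to the span. The basis
  grows by one Newton step for each function whose interpolation error \<open>r\<close> does not vanish, at a
  point where \<open>r \<noteq> 0\<close>. A function with \<open>r = 0\<close> on \<open>S\<close> is already reproduced by the current basis.
\<close>

lemma finite_interpolation:
  fixes g :: "nat \<Rightarrow> 'a::topological_space \<Rightarrow> real"
  assumes "\<And>j. j < m \<Longrightarrow> continuous_on S (g j)"
  shows "\<exists>(k::nat) y l. (\<forall>i<k. y i \<in> S \<and> continuous_on S (l i)) \<and>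
           (\<forall>j<m. \<forall>x\<in>S. g j x = (\<Sum>i<k. g j (y i) * l i x))"
  using assms
proof (induction m)
  case 0
  show ?case by (rule exI[of _ 0]) simp
next
  case (Suc m)
  have "\<exists>(k::nat) y l. (\<forall>i<k. y i \<in> S \<and> continuous_on S (l i)) \<and>
      (\<forall>j<m. \<forall>x\<in>S. g j x = (\<Sum>i<k. g j (y i) * l i x))"
    by (rule Suc.IH) (simp add: Suc.prems)
  then obtain k :: nat and y l where
    yl: "\<And>i. i < k \<Longrightarrow> y i \<in> S" "\<And>i. i < k \<Longrightarrow> continuous_on S (l i)" and
    interp: "\<And>j x. j < m \<Longrightarrow> x \<in> S \<Longrightarrow> g j x = (\<Sum>i<k. g j (y i) * l i x)"
    by blast
  define r where "r = (\<lambda>x. g m x - (\<Sum>i<k. g m (y i) * l i x))"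
  have r_cont: "continuous_on S r"
    unfolding r_def using yl(2) Suc.prems by (intro continuous_intros) auto
  show ?case
  proof (cases "\<forall>x\<in>S. r x = 0")
    case True
    then have "\<forall>j<Suc m. \<forall>x\<in>S. g j x = (\<Sum>i<k. g j (y i) * l i x)"
      using interp by (auto simp: less_Suc_eq r_def)
    then show ?thesis using yl by blast
  next
    case False
    then obtain z where z: "z \<in> S" "r z \<noteq> 0" by blast
    define y' where "y' = y(k := z)"
    define l' where
      "l' = (\<lambda>i x. if i < k then l i x - l i z * (r x / r z) else r x / r z)"
    \<comment> \<open>The extended formula adds to the old interpolant of \<open>h\<close> its error at \<open>z\<close>, times \<open>r / r z\<close>.\<close>
    have newton: "(\<Sum>i<Suc k. h (y' i) * l' i x) =
        (\<Sum>i<k. h (y i) * l i x) + (h z - (\<Sum>i<k. h (y i) * l i z)) * (r x / r z)" for h x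
    proof -
      have "(\<Sum>i<k. h (y' i) * l' i x) = (\<Sum>i<k. h (y i) * (l i x - l i z * (r x / r z)))"
        by (intro sum.cong) (auto simp: y'_def l'_def)
      also have "\<dots> = (\<Sum>i<k. h (y i) * l i x) - (\<Sum>i<k. h (y i) * l i z) * (r x / r z)"
        by (simp add: right_diff_distrib sum_subtractf sum_distrib_right mult.assoc
            sum_divide_distrib)
      finally show ?thesis
        by (simp add: y'_def l'_def left_diff_distrib diff_divide_distrib)
    qed
    have "g j x = (\<Sum>i<Suc k. g j (y' i) * l' i x)" if "j < Suc m" "x \<in> S" for j x
    proof (cases "j < m")
      case True
      then show ?thesis unfolding newton using interp[OF True] that(2) z(1) by simp
    next
      case False
      with that have [simp]: "j = m" by simp
      have "g m z - (\<Sum>i<k. g m (y i) * l i z) = r z" by (simp add: r_def)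
      then show ?thesis unfolding newton using z(2) by (simp add: r_def)
    qed
    moreover have "y' i \<in> S \<and> continuous_on S (l' i)" if "i < Suc k" for i
    proof (cases "i < k")
      case True
      then show ?thesis
        unfolding y'_def l'_def using yl z r_cont by (auto intro!: continuous_intros)
    next
      case False
      with that have "i = k" by simp
      then show ?thesis
        unfolding y'_def l'_def using z r_cont by (auto intro!: continuous_intros)
    qed
    ultimately show ?thesis by blast
  qed
qed

text \<open>
  The interpolation nodes alone would give a constant that depends on the \<open>l\<^sub>i\<close>. Including them in
  \<open>X\<close> makes the coefficients \<open>v (y\<^sub>i)\<close> bounded by the discrete norm, so that the \<open>\<epsilon>\<close>-net error is at
  most \<open>\<epsilon>\<close> times that norm.
\<close>

lemma finite_norming_set:
  fixes g :: "nat \<Rightarrow> 'a::topological_space \<Rightarrow> real"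
  assumes "compact S" "S \<noteq> {}"
    and cont: "\<And>j. j < m \<Longrightarrow> continuous_on S (g j)"
    and "0 < \<epsilon>"
  shows "\<exists>X. finite X \<and> X \<noteq> {} \<and> X \<subseteq> S \<and>
    (\<forall>v c. (\<forall>x\<in>S. v x = (\<Sum>j<m. c j * g j x)) \<longrightarrow>
       sup_norm_on S v \<le> (1 + \<epsilon>) * sup_norm_on X v)"
proof -
  obtain k :: nat and y l where
    yl: "\<And>i. i < k \<Longrightarrow> y i \<in> S" "\<And>i. i < k \<Longrightarrow> continuous_on S (l i)" and
    interp: "\<And>j x. j < m \<Longrightarrow> x \<in> S \<Longrightarrow> g j x = (\<Sum>i<k. g j (y i) * l i x)"
    using finite_interpolation[of m S g] cont by blast
  \<comment> \<open>Close in this sense means close for every function in the span, uniformly.\<close>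
  define near where "near = (\<lambda>z x. (\<Sum>i<k. \<bar>l i x - l i z\<bar>) < \<epsilon>)"
  have "\<exists>A. open A \<and> A \<inter> S = {x\<in>S. near z x}" for z
  proof -
    have "continuous_on S (\<lambda>x. \<Sum>i<k. \<bar>l i x - l i z\<bar>)"
      using yl(2) by (intro continuous_intros) auto
    then obtain A where "open A" "A \<inter> S = (\<lambda>x. \<Sum>i<k. \<bar>l i x - l i z\<bar>) -` {..<\<epsilon>} \<inter> S"
      unfolding continuous_on_open_invariant using open_lessThan by blast
    then show ?thesis by (intro exI[of _ A]) (auto simp: near_def)
  qed
  then obtain A where A: "\<And>z. open (A z)" "\<And>z. A z \<inter> S = {x\<in>S. near z x}" by metis
  have "near z z" for z using \<open>0 < \<epsilon>\<close> by (simp add: near_def)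
  then have "z \<in> A z" if "z \<in> S" for z using A(2)[of z] that by blast
  then have "S \<subseteq> (\<Union>z\<in>S. A z)" by blast
  then obtain Z where Z: "Z \<subseteq> S" "finite Z" "S \<subseteq> (\<Union>z\<in>Z. A z)"
    using compactE_image[OF \<open>compact S\<close>, of S A] A(1) by metis
  define X where "X = Z \<union> y ` {..<k}"
  have X: "finite X" "X \<noteq> {}" "X \<subseteq> S"
    using Z yl(1) \<open>S \<noteq> {}\<close> by (auto simp: X_def)
  have "sup_norm_on S v \<le> (1 + \<epsilon>) * sup_norm_on X v"
    if v: "\<And>x. x \<in> S \<Longrightarrow> v x = (\<Sum>j<m. c j * g j x)" for v c
  proof (rule sup_norm_on_least[OF \<open>S \<noteq> {}\<close>])
    fix x assume "x \<in> S"
    then obtain z where z: "z \<in> Z" "near z x" using Z(3) A(2) by blast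
    have bound: "\<bar>v w\<bar> \<le> sup_norm_on X v" if "w \<in> X" for w
      using that X(1) by (intro abs_le_sup_norm_on) auto
    have rep: "v w = (\<Sum>i<k. v (y i) * l i w)" if "w \<in> S" for w
    proof -
      have "v w = (\<Sum>j<m. c j * (\<Sum>i<k. g j (y i) * l i w))"
        using v[OF that] interp that by simp
      also have "\<dots> = (\<Sum>i<k. (\<Sum>j<m. c j * g j (y i)) * l i w)"
        unfolding sum_distrib_left sum_distrib_right
        by (subst sum.swap) (simp add: mult.assoc)
      also have "\<dots> = (\<Sum>i<k. v (y i) * l i w)" using v yl(1) by simp
      finally show ?thesis .
    qed
    have "v x - v z = (\<Sum>i<k. v (y i) * (l i x - l i z))"
      using rep[of x] rep[of z] z(1) Z(1) \<open>x \<in> S\<close>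
      by (auto simp: right_diff_distrib sum_subtractf)
    also have "\<bar>\<dots>\<bar> \<le> (\<Sum>i<k. \<bar>v (y i) * (l i x - l i z)\<bar>)" by (rule sum_abs)
    also have "\<dots> \<le> (\<Sum>i<k. sup_norm_on X v * \<bar>l i x - l i z\<bar>)"
      unfolding abs_mult by (intro sum_mono mult_right_mono bound) (auto simp: X_def)
    also have "\<dots> \<le> sup_norm_on X v * \<epsilon>"
      unfolding sum_distrib_left[symmetric]
      using z(2) X sup_norm_on_nonneg[of X v] by (intro mult_left_mono) (auto simp: near_def)
    finally have "\<bar>v x - v z\<bar> \<le> sup_norm_on X v * \<epsilon>" .
    moreover have "\<bar>v z\<bar> \<le> sup_norm_on X v" using z(1) by (intro bound) (simp add: X_def)
    ultimately show "\<bar>v x\<bar> \<le> (1 + \<epsilon>) * sup_norm_on X v" by (simp add: algebra_simps)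
  qed
  with X show ?thesis by (intro exI[of _ X]) simp
qed

section \<open>Linearity of the differential operator\<close>

text \<open>
  One induction step for the linearity of iterated partial derivatives. Linearity of the inner
  derivatives is needed on the whole open interior, because the outer derivative sees a neighbourhood.
\<close>

lemma has_derivative_iter_partial_lin_comb:
  fixes u :: "nat \<Rightarrow> real ^ 'd \<Rightarrow> real"
  assumes u: "\<And>j. j < n \<Longrightarrow> u j \<in> Cp_space p \<Omega>"
    and "length ks < p" "x \<in> interior \<Omega>"
    and lin: "\<And>y. y \<in> interior \<Omega> \<Longrightarrow>
      iter_partial ks (\<lambda>x. \<Sum>j<n. c j * u j x) y = (\<Sum>j<n. c j * iter_partial ks (u j) y)"
  shows "((\<lambda>t. iter_partial ks (\<lambda>x. \<Sum>j<n. c j * u j x) (x + t *\<^sub>R axis i 1)) has_real_derivative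
      (\<Sum>j<n. c j * iter_partial (i # ks) (u j) x)) (at 0)"
proof -
  have "((\<lambda>t. iter_partial ks (u j) (x + t *\<^sub>R axis i 1)) has_real_derivative
      iter_partial (i # ks) (u j) x) (at 0)" if "j < n" for j
  proof -
    have "(\<lambda>t. iter_partial ks (u j) (x + t *\<^sub>R axis i 1)) differentiable (at 0)"
      using u[OF that] assms(2,3) by (auto simp: Cp_space_def)
    then show ?thesis by (simp add: partial_def DERIV_deriv_iff_real_differentiable)
  qed
  then have deriv_sum: "((\<lambda>t. \<Sum>j<n. c j * iter_partial ks (u j) (x + t *\<^sub>R axis i 1)) has_real_derivative
      (\<Sum>j<n. c j * iter_partial (i # ks) (u j) x)) (at 0)"
    by (intro DERIV_sum DERIV_cmult) auto
  have "eventually (\<lambda>t::real. x + t *\<^sub>R axis i 1 \<in> interior \<Omega>) (nhds 0)"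
  proof -
    have "((\<lambda>t::real. x + t *\<^sub>R axis i 1) \<longlongrightarrow> x + 0 *\<^sub>R axis i 1) (nhds 0)"
      by (intro tendsto_intros filterlim_ident)
    then show ?thesis using assms(3) open_interior topological_tendstoD by fastforce
  qed
  then have eq_near: "eventually (\<lambda>t. (\<Sum>j<n. c j * iter_partial ks (u j) (x + t *\<^sub>R axis i 1)) =
      iter_partial ks (\<lambda>x. \<Sum>j<n. c j * u j x) (x + t *\<^sub>R axis i 1)) (nhds 0)"
    by eventually_elim (simp add: lin)
  show ?thesis using deriv_sum unfolding DERIV_cong_ev[OF refl eq_near refl] .
qed

lemma iter_partial_lin_comb:
  fixes u :: "nat \<Rightarrow> real ^ 'd \<Rightarrow> real"
  assumes "\<And>j. j < n \<Longrightarrow> u j \<in> Cp_space p \<Omega>" "length ks \<le> p" "x \<in> interior \<Omega>"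
  shows "iter_partial ks (\<lambda>x. \<Sum>j<n. c j * u j x) x = (\<Sum>j<n. c j * iter_partial ks (u j) x)"
  using assms(2,3)
proof (induction ks arbitrary: x)
  case Nil
  show ?case by simp
next
  case (Cons i ks)
  have "((\<lambda>t. iter_partial ks (\<lambda>x. \<Sum>j<n. c j * u j x) (x + t *\<^sub>R axis i 1)) has_real_derivative
      (\<Sum>j<n. c j * iter_partial (i # ks) (u j) x)) (at 0)"
    using Cons by (intro has_derivative_iter_partial_lin_comb[OF assms(1)]) auto
  from DERIV_imp_deriv[OF this] show ?case by (simp add: partial_def)
qed

lemma lin_comb_in_Cp_space:
  fixes u :: "nat \<Rightarrow> real ^ 'd \<Rightarrow> real"
  assumes u: "\<And>j. j < n \<Longrightarrow> u j \<in> Cp_space p \<Omega>"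
  shows "(\<lambda>x. \<Sum>j<n. c j * u j x) \<in> Cp_space p \<Omega>"
  unfolding Cp_space_def
proof (intro CollectI conjI allI impI ballI)
  show "continuous_on \<Omega> (\<lambda>x. \<Sum>j<n. c j * u j x)"
    using u by (intro continuous_intros) (auto simp: Cp_space_def)
next
  fix ks :: "'d list" and i x
  assume ks: "length ks < p" and x: "x \<in> interior \<Omega>"
  have "((\<lambda>t. iter_partial ks (\<lambda>x. \<Sum>j<n. c j * u j x) (x + t *\<^sub>R axis i 1)) has_real_derivative
      (\<Sum>j<n. c j * iter_partial (i # ks) (u j) x)) (at 0)"
    using ks x iter_partial_lin_comb[OF u]
    by (intro has_derivative_iter_partial_lin_comb[OF u]) auto
  then show "(\<lambda>t. iter_partial ks (\<lambda>x. \<Sum>j<n. c j * u j x) (x + t *\<^sub>R axis i 1))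
      differentiable (at 0)"
    using real_differentiable_def by blast
next
  fix ks :: "'d list"
  assume ks: "length ks \<le> p"
  then have "\<forall>j\<in>{..<n}. \<exists>g. continuous_on \<Omega> g \<and> (\<forall>x\<in>interior \<Omega>. g x = iter_partial ks (u j) x)"
    using u by (auto simp: Cp_space_def)
  from bchoice[OF this] obtain g where g: "\<forall>j\<in>{..<n}. continuous_on \<Omega> (g j) \<and>
      (\<forall>x\<in>interior \<Omega>. g j x = iter_partial ks (u j) x)" ..
  show "\<exists>g. continuous_on \<Omega> g \<and>
      (\<forall>x\<in>interior \<Omega>. g x = iter_partial ks (\<lambda>x. \<Sum>j<n. c j * u j x) x)"
  proof (intro exI conjI ballI)
    show "continuous_on \<Omega> (\<lambda>x. \<Sum>j<n. c j * g j x)"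
      using g by (intro continuous_intros) auto
    show "(\<Sum>j<n. c j * g j x) = iter_partial ks (\<lambda>x. \<Sum>j<n. c j * u j x) x"
      if "x \<in> interior \<Omega>" for x
      using g that iter_partial_lin_comb[OF u ks that] by simp
  qed
qed

lemma differential_operator_linear:
  fixes u :: "nat \<Rightarrow> real ^ 'd \<Rightarrow> real"
  assumes "compact_domain \<Omega>" "linear_differential_operator p \<Omega> D"
    and u: "\<And>j. j < n \<Longrightarrow> u j \<in> Cp_space p \<Omega>" and "x \<in> \<Omega>"
  shows "D (\<lambda>x. \<Sum>j<n. c j * u j x) x = (\<Sum>j<n. c j * D (u j) x)"
proof -
  let ?w = "\<lambda>x. \<Sum>j<n. c j * u j x"
  obtain a where D_cont: "\<And>v. v \<in> Cp_space p \<Omega> \<Longrightarrow> continuous_on \<Omega> (D v)"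
    and D_int: "\<And>v x. v \<in> Cp_space p \<Omega> \<Longrightarrow> x \<in> interior \<Omega> \<Longrightarrow>
      D v x = (\<Sum>ks | length ks \<le> p. a ks x * iter_partial ks v x)"
    using assms(2) unfolding linear_differential_operator_def C_space_def by auto
  have w: "?w \<in> Cp_space p \<Omega>" by (rule lin_comb_in_Cp_space[OF u])
  define h where "h = (\<lambda>x. D ?w x - (\<Sum>j<n. c j * D (u j) x))"
  have "h y = 0" if y: "y \<in> interior \<Omega>" for y
  proof -
    have "D ?w y = (\<Sum>ks | length ks \<le> p. \<Sum>j<n. c j * (a ks y * iter_partial ks (u j) y))"
      unfolding D_int[OF w y]
      by (intro sum.cong refl)
        (simp add: iter_partial_lin_comb[OF u _ y] sum_distrib_left mult.left_commute)
    also have "\<dots> = (\<Sum>j<n. c j * D (u j) y)"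
      using u y by (subst sum.swap) (simp add: D_int sum_distrib_left)
    finally show ?thesis by (simp add: h_def)
  qed
  moreover have dense: "closure (interior \<Omega>) = \<Omega>" using assms(1) by (simp add: compact_domain_def)
  moreover have "continuous_on \<Omega> h"
    unfolding h_def using w u by (intro continuous_intros D_cont) auto
  ultimately have "h x = 0"
    using continuous_constant_on_closure[of "interior \<Omega>" h 0 x] \<open>x \<in> \<Omega>\<close> by simp
  then show ?thesis by (simp add: h_def)
qed

section \<open>Uniform stability and the error comparison\<close>

theorem theorem6:
  fixes \<Omega> :: "(real ^ 'd) set"
    and p :: nat
    and D :: "(real ^ 'd \<Rightarrow> real) \<Rightarrow> (real ^ 'd \<Rightarrow> real)"
    and U F :: "(real ^ 'd \<Rightarrow> real) set"
    and f :: "real ^ 'd \<Rightarrow> real"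
  assumes "compact_domain \<Omega>"
    and "linear_differential_operator p \<Omega> D"
    and "trial_spaces p \<Omega> D U F"
    and "f \<in> C_space \<Omega>"
  shows "\<exists>X. finite X \<and> X \<noteq> {} \<and> X \<subseteq> \<Omega> \<and>
           stable_discretization 2 \<Omega> X F \<and>
           approx_error \<Omega> f F \<le> 2 * approx_error X f F"
proof -
  obtain n u where u: "\<And>j. j < n \<Longrightarrow> u j \<in> Cp_space p \<Omega>"
    and F: "F = D ` lin_comb_space n u"
    using assms(3) unfolding trial_spaces_def by blast
  have \<Omega>: "compact \<Omega>" "\<Omega> \<noteq> {}" using assms(1) by (auto simp: compact_domain_def)
  have f_cont: "continuous_on \<Omega> f" using assms(4) by (simp add: C_space_def)
  have D_cont: "continuous_on \<Omega> (D v)" if "v \<in> Cp_space p \<Omega>" for v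
    using assms(2) that by (auto simp: linear_differential_operator_def C_space_def)
  have F_nonempty: "F \<noteq> {}" by (auto simp: F lin_comb_space_def)
  have F_cont: "continuous_on \<Omega> g" if "g \<in> F" for g
    using that lin_comb_in_Cp_space[OF u] by (auto simp: F lin_comb_space_def intro!: D_cont)
  have F_span: "\<exists>c. \<forall>x\<in>\<Omega>. g x = (\<Sum>j<n. c j * D (u j) x)" if g: "g \<in> F" for g
  proof -
    obtain c where "g = D (\<lambda>x. \<Sum>j<n. c j * u j x)"
      using g unfolding F lin_comb_space_def by blast
    then have "\<forall>x\<in>\<Omega>. g x = (\<Sum>j<n. c j * D (u j) x)"
      by (simp add: differential_operator_linear[OF assms(1,2) u])
    then show ?thesis by blast
  qed
  define G where "G = (\<lambda>j. if j < n then D (u j) else f)"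
  have G_cont: "continuous_on \<Omega> (G j)" for j
    using u D_cont f_cont by (simp add: G_def)
  obtain X where X: "finite X" "X \<noteq> {}" "X \<subseteq> \<Omega>"
    and norming: "\<forall>v c. (\<forall>x\<in>\<Omega>. v x = (\<Sum>j<Suc n. c j * G j x)) \<longrightarrow>
      sup_norm_on \<Omega> v \<le> (1 + 1) * sup_norm_on X v"
    using finite_norming_set[where g = G and m = "Suc n" and \<epsilon> = 1,
        OF \<Omega> G_cont zero_less_one]
    by (elim exE conjE)
  \<comment> \<open>Every element of \<open>F\<close> and every residual is \<open>b * f + g\<close> with \<open>g\<close> in the span of the \<open>D u\<^sub>j\<close>.\<close>
  have norming': "sup_norm_on \<Omega> v \<le> 2 * sup_norm_on X v"
    if "\<And>x. x \<in> \<Omega> \<Longrightarrow> v x = b * f x + (\<Sum>j<n. c j * D (u j) x)" for v b c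
    using norming[rule_format, of v "c(n := b)"] that by (simp add: G_def)
  have "stable_discretization 2 \<Omega> X F"
    unfolding stable_discretization_def
  proof
    fix g assume "g \<in> F"
    then obtain c where "\<forall>x\<in>\<Omega>. g x = (\<Sum>j<n. c j * D (u j) x)" using F_span by blast
    then show "sup_norm_on \<Omega> g \<le> 2 * sup_norm_on X g" using norming'[of g 0 c] by simp
  qed
  moreover have "approx_error \<Omega> f F \<le> 2 * approx_error X f F"
  proof -
    have "approx_error \<Omega> f F / 2 \<le> sup_norm_on X (\<lambda>x. f x - g x)" if g: "g \<in> F" for g
    proof -
      have "0 \<le> sup_norm_on \<Omega> (\<lambda>x. f x - h x)" if "h \<in> F" for h
      proof (rule sup_norm_on_nonneg[OF \<Omega>(2)])
        have "compact ((\<lambda>x. \<bar>f x - h x\<bar>) ` \<Omega>)"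
          using \<Omega>(1) f_cont F_cont[OF that]
          by (intro compact_continuous_image continuous_intros)
        then show "bdd_above ((\<lambda>x. \<bar>f x - h x\<bar>) ` \<Omega>)"
          by (intro bounded_imp_bdd_above compact_imp_bounded)
      qed
      then have "approx_error \<Omega> f F \<le> sup_norm_on \<Omega> (\<lambda>x. f x - g x)"
        unfolding approx_error_def using g by (intro cINF_lower bdd_belowI2[of _ 0])
      moreover obtain c where "\<forall>x\<in>\<Omega>. g x = (\<Sum>j<n. c j * D (u j) x)"
        using F_span[OF g] by blast
      then have "sup_norm_on \<Omega> (\<lambda>x. f x - g x) \<le> 2 * sup_norm_on X (\<lambda>x. f x - g x)"
        using norming'[of "\<lambda>x. f x - g x" 1 "\<lambda>j. - c j"] by (simp add: sum_negf)
      ultimately show ?thesis by simp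
    qed
    then have "approx_error \<Omega> f F / 2 \<le> approx_error X f F"
      unfolding approx_error_def[of X] using F_nonempty by (intro cINF_greatest)
    then show ?thesis by simp
  qed
  ultimately show ?thesis using X by blast
qed

end
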